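(* Let $d\ge 2$ and $N\ge 2$ be integers and let $K\subsetneq[0,1]^d$ be a closed $T_N$-invariant set. Then $K$ is tube-null. Moreover, there is a constant $c\in(0,1)$ such that for every $\varepsilon>0$ there are countably many affine hyperplanes $(H_i)$ in $\mathbb R^d$ and numbers $r_i>0$ with $\sum_i r_i^{c}<\varepsilon$ and $K\subset\bigcup_i H_i(r_i)$.
   Context: $T_N$ denotes the $\times N$ map on the $d$-dimensional torus $\mathbb R^d/\mathbb Z^d$, identified with $[0,1]^d$: $T_N(x_1,\dots,x_d)=(Nx_1 \bmod 1,\dots,Nx_d\bmod 1)$. A set $K\subset[0,1]^d$ is $T_N$-invariant if $T_N(K)\subset K$ under this identification, i.e. for each $x\in K$ there is $y\in K$ with $y\equiv Nx \pmod{\mathbb Z^d}$. A tube $T$ of width $w=w(T)>0$ is the $w$-neighborhood of a line in $\mathbb R^d$. A set $K\subset\mathbb R^d$ is tube-null if for every $\varepsilon>0$ there is a countable family of tubes $\{T_i\}$ with $K\subset\bigcup_iT_i$ and $\sum_i w(T_i)^{d-1}<\varepsilon$. For a hyperplane $H$ and $r>0$, $H(r)$ denotes the $r$-neighborhood of $H$. *)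

theory Defs
  imports "HOL-Analysis.Analysis"
begin

definition line :: "'a::euclidean_space set \<Rightarrow> bool" where
  "line L \<longleftrightarrow> affine L \<and> aff_dim L = 1"

definition hyperplane :: "'a::euclidean_space set \<Rightarrow> bool" where
  "hyperplane H \<longleftrightarrow> affine H \<and> aff_dim H = int DIM('a) - 1"

definition nbhd :: "'a::metric_space set \<Rightarrow> real \<Rightarrow> 'a set" where
  "nbhd A r = (\<Union>a\<in>A. ball a r)"

text \<open>A countable family is indexed by an arbitrary set of naturals, so that finite and
  empty families are included.  Summability is demanded explicitly because
  \<^const>\<open>infsum\<close> is 0 on non-summable families.\<close>

definition tube_null :: "'a::euclidean_space set \<Rightarrow> bool" where
  "tube_null K \<longleftrightarrow>
    (\<forall>\<epsilon>>0. \<exists>(I :: nat set) (L :: nat \<Rightarrow> 'a set) (w :: nat \<Rightarrow> real).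
      (\<forall>i\<in>I. line (L i) \<and> w i > 0) \<and>
      K \<subseteq> (\<Union>i\<in>I. nbhd (L i) (w i)) \<and>
      (\<lambda>i. w i ^ (DIM('a) - 1)) summable_on I \<and>
      (\<Sum>\<^sub>\<infinity>i\<in>I. w i ^ (DIM('a) - 1)) < \<epsilon>)"

definition torus_map :: "nat \<Rightarrow> real ^ 'n \<Rightarrow> real ^ 'n" where
  "torus_map N x = (\<chi> i. frac (real N * x $ i))"

definition torus_cong :: "real ^ 'n \<Rightarrow> real ^ 'n \<Rightarrow> bool" where
  "torus_cong x y \<longleftrightarrow> (\<forall>i. x $ i - y $ i \<in> \<int>)"

text \<open>Points of the closed unit cube represent points of the torus, so \<open>torus_map N x\<close>
  only has to lie in \<open>K\<close> up to an integer vector: opposite faces are identified, whereas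
  \<^const>\<open>frac\<close> always selects the representative in the half-open cube.\<close>

definition torus_invariant :: "nat \<Rightarrow> (real ^ 'n) set \<Rightarrow> bool" where
  "torus_invariant N K \<longleftrightarrow> (\<forall>x\<in>K. \<exists>y\<in>K. torus_cong y (torus_map N x))"

lemma torus_cong_torus_map:
  "torus_cong y (torus_map N x) \<longleftrightarrow> torus_cong y (real N *\<^sub>R x)"
proof -
  have "a - frac b \<in> \<int> \<longleftrightarrow> a - b \<in> \<int>" for a b :: real
  proof -
    have "a - frac b = (a - b) + of_int \<lfloor>b\<rfloor>"
      by (simp add: frac_def)
    then show ?thesis
      by (metis Ints_add Ints_diff Ints_of_int add_diff_cancel_right')
  qed
  then show ?thesis
    by (simp add: torus_cong_def torus_map_def)
qed

end

theory Submission
  imports Defs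
begin

text \<open>Since \<open>K\<close> misses a cube around some point \<open>a\<close>, the trigonometric polynomial
  \<open>W x = (\<Prod>i. cos (\<pi> (x i - a i)) ^ (2 m))\<close> is, for large \<open>m\<close>, at most \<open>W\<^sub>0 - \<delta>\<close> on \<open>K\<close>, where \<open>W\<^sub>0\<close>
  is its mean. Averaging \<open>W\<close> along the orbit of a point \<open>x \<in> K\<close> shows that for every \<open>n\<close> one of
  finitely many nonzero integer frequencies \<open>v\<close> has a biased exponential sum: with a suitable
  phase \<open>\<phi>\<close>, \<open>(\<Sum>k<n. cos (2 \<pi> N^k (v \<bullet> x) + \<phi>)) \<ge> \<delta> n\<close>. In the variable \<open>t = v \<bullet> x\<close> modulo 1 this
  is a large deviation event for a reverse martingale, so at scale \<open>N^(-n)\<close> it is covered by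
  \<open>O(N^(n (1 - \<eta>)))\<close> intervals for some \<open>\<eta> > 0\<close>, and \<open>K\<close> is covered by as many slabs
  orthogonal to the vectors \<open>v\<close>. Cutting each slab of width \<open>r\<close> into \<open>O(r^(2 - d))\<close> tubes gives
  tube-nullity.\<close>

subsection \<open>Large deviations of lacunary cosine sums\<close>

text \<open>The Birkhoff sum of a shifted cosine along the orbit of \<open>t\<close> under
  multiplication by \<open>N\<close> modulo 1. The phase later carries both the centre of the bump
  and a sign.\<close>

definition cos_sum :: "nat \<Rightarrow> real \<Rightarrow> nat \<Rightarrow> real \<Rightarrow> real" where
  "cos_sum N \<phi> n t = (\<Sum>k<n. cos (2 * pi * (real N ^ k * t) + \<phi>))"

lemma abs_cos_diff_le: "\<bar>cos x - cos y\<bar> \<le> \<bar>x - y\<bar>" for x y :: real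
proof -
  have "\<bar>cos x - cos y\<bar> = 2 * \<bar>sin ((x + y) / 2)\<bar> * \<bar>sin ((y - x) / 2)\<bar>"
    by (simp add: cos_diff_cos abs_mult)
  also have "\<dots> \<le> 2 * 1 * \<bar>(y - x) / 2\<bar>"
    by (intro mult_mono abs_sin_x_le_abs_x) auto
  finally show ?thesis
    by simp
qed

lemma cos_add_int: "cos (2 * pi * (of_int l + t) + \<phi>) = cos (2 * pi * t + \<phi>)"
proof -
  have "2 * pi * (of_int l + t) + \<phi> = 2 * pi * of_int l + (2 * pi * t + \<phi>)"
    by (simp add: algebra_simps)
  then show ?thesis
    by (simp only: cos_add cos_int_2pin sin_int_2pin) simp
qed

lemma cos_sum_add_int: "cos_sum N \<phi> n (of_int l + t) = cos_sum N \<phi> n t"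
proof -
  have "real N ^ k * (of_int l + t) = of_int (int N ^ k * l) + real N ^ k * t" for k
    by (simp add: algebra_simps)
  then show ?thesis
    unfolding cos_sum_def by (simp only: cos_add_int)
qed

text \<open>Splitting off the first term instead of the last leaves a sum of the same shape at
  \<open>real N * t\<close>, as the induction over preimages requires.\<close>

lemma cos_sum_Suc:
  "cos_sum N \<phi> (Suc n) t = cos (2 * pi * t + \<phi>) + cos_sum N \<phi> n (real N * t)"
  unfolding cos_sum_def by (simp add: sum.lessThan_Suc_shift mult_ac del: sum.lessThan_Suc)

text \<open>A shift by half a period turns a lower deviation into an upper one, so only upper
  deviations have to be counted.\<close>

lemma cos_sum_pi: "cos_sum N (\<phi> + pi) n t = - cos_sum N \<phi> n t"
  unfolding cos_sum_def by (simp flip: add.assoc sum_negf)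

lemma sum_power_le_power:
  fixes N :: nat assumes "N \<ge> 2" shows "(\<Sum>k<n. real N ^ k) \<le> real N ^ n"
proof (induction n)
  case (Suc n)
  have "real N ^ n + real N ^ n \<le> real N * real N ^ n"
    using assms by (metis mult_2 mult_right_mono of_nat_mono of_nat_numeral zero_le_power of_nat_0_le_iff)
  with Suc show ?case by simp
qed auto

text \<open>The \<open>k\<close>-th term has Lipschitz constant \<open>2 * pi * N ^ k\<close>. These
  constants add up to at most \<open>2 * pi * N ^ n\<close>, so the oscillation at scale
  \<open>1 / N ^ n\<close> is bounded independently of \<open>n\<close>.\<close>

lemma cos_sum_diff_le:
  assumes "N \<ge> 2" and "\<bar>t - s\<bar> \<le> 1 / real N ^ n"
  shows "\<bar>cos_sum N \<phi> n t - cos_sum N \<phi> n s\<bar> \<le> 2 * pi"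
proof -
  have "\<bar>cos_sum N \<phi> n t - cos_sum N \<phi> n s\<bar>
      \<le> (\<Sum>k<n. \<bar>cos (2 * pi * (real N ^ k * t) + \<phi>) - cos (2 * pi * (real N ^ k * s) + \<phi>)\<bar>)"
    unfolding cos_sum_def by (simp flip: sum_subtractf)
  also have "\<dots> \<le> (\<Sum>k<n. real N ^ k * (2 * pi / real N ^ n))"
  proof (rule sum_mono)
    fix k
    have "\<bar>cos (2 * pi * (real N ^ k * t) + \<phi>) - cos (2 * pi * (real N ^ k * s) + \<phi>)\<bar>
        \<le> \<bar>2 * pi * real N ^ k * (t - s)\<bar>"
      using abs_cos_diff_le[of "2 * pi * (real N ^ k * t) + \<phi>" "2 * pi * (real N ^ k * s) + \<phi>"]
      by (simp add: algebra_simps)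
    also have "\<dots> = 2 * pi * real N ^ k * \<bar>t - s\<bar>"
      by (simp add: abs_mult)
    also have "\<dots> \<le> 2 * pi * real N ^ k * (1 / real N ^ n)"
      using assms(2) by (intro mult_left_mono) auto
    finally show "\<bar>cos (2 * pi * (real N ^ k * t) + \<phi>) - cos (2 * pi * (real N ^ k * s) + \<phi>)\<bar>
        \<le> real N ^ k * (2 * pi / real N ^ n)"
      by (simp add: field_simps)
  qed
  also have "\<dots> = (\<Sum>k<n. real N ^ k) * (2 * pi / real N ^ n)"
    by (rule sum_distrib_right[symmetric])
  also have "\<dots> \<le> real N ^ n * (2 * pi / real N ^ n)"
    by (intro mult_right_mono sum_power_le_power assms) auto
  finally show ?thesis
    using assms by simp
qed

text \<open>The summands are real parts of a geometric progression whose ratio is a nontrivial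
  \<open>N\<close>-th root of unity.\<close>

lemma sum_cos_equidistant:
  fixes N :: nat assumes "N \<ge> 2"
  shows "(\<Sum>i<N. cos (2 * pi * ((real i + u) / real N) + \<phi>)) = 0"
proof -
  define \<omega> where "\<omega> = cis (2 * pi / real N)"
  have \<omega>: "\<omega> ^ N = 1"
  proof -
    have "real N * (2 * pi / real N) = 2 * pi"
      using assms by simp
    then show ?thesis
      unfolding \<omega>_def by (simp only: Complex.DeMoivre cis_2pi)
  qed
  have "\<omega> \<noteq> 1"
  proof
    assume "\<omega> = 1"
    then have "cos (2 * pi / real N) = 1"
      by (metis \<omega>_def cis.sel(1) one_complex.sel(1))
    then obtain k :: int where "2 * pi / real N = real_of_int k * 2 * pi"
      unfolding cos_one_2pi_int by blast
    then have "1 = real_of_int (k * int N)"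
      using assms by (simp add: field_simps)
    then have "k * int N = 1"
      by linarith
    then show False
      using assms by (simp add: zmult_eq_1_iff)
  qed
  have "(\<Sum>i<N. cis (2 * pi * ((real i + u) / real N) + \<phi>))
      = (\<Sum>i<N. cis (2 * pi * u / real N + \<phi>) * \<omega> ^ i)"
    unfolding \<omega>_def by (simp add: Complex.DeMoivre cis_mult add_divide_distrib algebra_simps)
  also have "\<dots> = 0"
    using \<omega> \<open>\<omega> \<noteq> 1\<close> by (simp add: sum_distrib_left[symmetric] geometric_sum)
  finally show ?thesis
    by (metis (no_types, lifting) Re_sum cis.sel(1) sum.cong zero_complex.sel(1))
qed

lemma exp_le_quadratic:
  fixes x :: real assumes "\<bar>x\<bar> \<le> 1" shows "exp x \<le> 1 + x + x\<^sup>2"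
proof (cases "x \<ge> 0")
  case True
  then show ?thesis using assms exp_bound[of x] by simp
next
  case False
  define y where "y = - x"
  have y: "0 \<le> y" "y \<le> 1" using False assms by (auto simp: y_def)
  \<comment> \<open>For negative \<open>x\<close> it suffices that the bound times
    \<open>exp y\<close> is at least 1, and the quadratic Taylor polynomial of \<open>exp y\<close>
    already achieves this.\<close>
  have "1 \<le> 1 + y\<^sup>2 / 2 * (1 + y + y\<^sup>2)"
    using y by simp
  also have "\<dots> = (1 - y + y\<^sup>2) * (1 + y + y\<^sup>2 / 2)"
    by (simp add: power2_eq_square field_simps)
  also have "\<dots> \<le> (1 - y + y\<^sup>2) * exp y"
    using y by (intro mult_left_mono exp_lower_Taylor_quadratic) auto
  finally have "exp (- y) \<le> 1 - y + y\<^sup>2"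
    by (simp add: exp_minus field_simps)
  then show ?thesis by (simp add: y_def)
qed

text \<open>The preimages of a point under \<open>t \<mapsto> N t\<close> are equidistant, so the cosines over them
  cancel; only the quadratic term of the exponential survives in each step.\<close>

lemma sum_exp_cos_sum_le:
  assumes N: "N \<ge> 2" and l: "0 \<le> l" "l \<le> 1"
  shows "(\<Sum>j<N ^ n. exp (l * cos_sum N \<phi> n (real j / real N ^ n)))
    \<le> (real N * (1 + l\<^sup>2)) ^ n"
proof (induction n)
  case 0
  then show ?case by (simp add: cos_sum_def)
next
  case (Suc n)
  let ?u = "\<lambda>j. real j / real N ^ n"
  \<comment> \<open>The indices \<open>i * N ^ n + j\<close> for \<open>i < N\<close> list the
    preimages \<open>(i + ?u j) / N\<close> of \<open>?u j\<close> under multiplication by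
    \<open>N\<close> modulo 1.\<close>
  have step: "exp (l * cos_sum N \<phi> (Suc n) (real (i * N ^ n + j) / real N ^ Suc n))
      = exp (l * cos (2 * pi * ((real i + ?u j) / real N) + \<phi>)) * exp (l * cos_sum N \<phi> n (?u j))"
    for i j
  proof -
    have "real (i * N ^ n + j) / real N ^ Suc n = (real i + ?u j) / real N"
      using N by (simp add: field_simps)
    moreover have "real N * ((real i + ?u j) / real N) = of_int (int i) + ?u j"
      using N by simp
    ultimately show ?thesis
      by (simp only: cos_sum_Suc cos_sum_add_int distrib_left exp_add)
  qed
  have mean: "(\<Sum>i<N. exp (l * cos (2 * pi * ((real i + u) / real N) + \<phi>)))
      \<le> real N * (1 + l\<^sup>2)" for u
  proof -
    let ?c = "\<lambda>i. cos (2 * pi * ((real i + u) / real N) + \<phi>)"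
    have "exp (l * ?c i) \<le> 1 + l * ?c i + l\<^sup>2" for i
    proof -
      have "\<bar>l * ?c i\<bar> \<le> 1"
        using l by (simp add: abs_mult mult_le_one)
      then have "exp (l * ?c i) \<le> 1 + l * ?c i + (l * ?c i)\<^sup>2"
        by (rule exp_le_quadratic)
      also have "(l * ?c i)\<^sup>2 \<le> l\<^sup>2"
        using l by (simp add: power_mult_distrib mult_left_le abs_square_le_1)
      finally show ?thesis by simp
    qed
    then have "(\<Sum>i<N. exp (l * ?c i)) \<le> (\<Sum>i<N. 1 + l * ?c i + l\<^sup>2)"
      by (intro sum_mono) auto
    also have "\<dots> = real N * (1 + l\<^sup>2) + l * (\<Sum>i<N. ?c i)"
      by (simp add: sum.distrib sum_distrib_left algebra_simps)
    finally show ?thesis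
      by (simp only: sum_cos_equidistant[OF N] mult_zero_right add_0_right)
  qed
  have "(\<Sum>j<N ^ Suc n. exp (l * cos_sum N \<phi> (Suc n) (real j / real N ^ Suc n)))
      = (\<Sum>i<N. \<Sum>j<N ^ n. exp (l * cos_sum N \<phi> (Suc n) (real (i * N ^ n + j) / real N ^ Suc n)))"
  proof -
    have "(\<Sum>j<N ^ Suc n. f j) = (\<Sum>i<N. \<Sum>j<N ^ n. f (i * N ^ n + j))" for f :: "nat \<Rightarrow> real"
    proof -
      have "(\<Sum>j<N ^ n. f (i * N ^ n + j)) = sum f {i * N ^ n..<i * N ^ n + N ^ n}" for i
        using sum.shift_bounds_nat_ivl[of f 0 "i * N ^ n" "N ^ n"]
        by (simp add: atLeast0LessThan add.commute)
      then show ?thesis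
        using sum.nat_group[of f "N ^ n" N] by simp
    qed
    then show ?thesis .
  qed
  also have "\<dots> = (\<Sum>j<N ^ n. (\<Sum>i<N. exp (l * cos (2 * pi * ((real i + ?u j) / real N) + \<phi>)))
      * exp (l * cos_sum N \<phi> n (?u j)))"
    unfolding step by (subst sum.swap) (simp add: sum_distrib_right)
  also have "\<dots> \<le> (\<Sum>j<N ^ n. real N * (1 + l\<^sup>2) * exp (l * cos_sum N \<phi> n (?u j)))"
    by (intro sum_mono mult_right_mono mean) auto
  also have "\<dots> \<le> real N * (1 + l\<^sup>2) * (real N * (1 + l\<^sup>2)) ^ n"
    unfolding sum_distrib_left[symmetric] using Suc by (intro mult_left_mono) auto
  finally show ?case by simp
qed

text \<open>The slack \<open>2 \<pi>\<close> absorbs the oscillation of the sum over an interval of length \<open>N^(-n)\<close>.\<close>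

definition large_dev :: "nat \<Rightarrow> real \<Rightarrow> real \<Rightarrow> nat \<Rightarrow> nat set" where
  "large_dev N \<delta> \<phi> n = {j. j < N ^ n \<and> \<delta> * real n - 2 * pi \<le> cos_sum N \<phi> n (real j / real N ^ n)}"

lemma finite_large_dev: "finite (large_dev N \<delta> \<phi> n)"
  unfolding large_dev_def by (rule finite_subset[of _ "{..<N ^ n}"]) auto

text \<open>A Chernoff bound: Markov's inequality for the exponential moment under the uniform
  measure on the grid of mesh \<open>1 / N ^ n\<close>.\<close>

lemma card_large_dev_le:
  assumes N: "N \<ge> 2" and \<delta>: "0 < \<delta>" "\<delta> \<le> 1"
  shows "real (card (large_dev N \<delta> \<phi> n)) \<le> exp pi * real N ^ n * exp (- (\<delta>\<^sup>2 / 4) * real n)"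
proof -
  \<comment> \<open>This value minimises \<open>l\<^sup>2 - l * \<delta>\<close>, with minimum
    \<open>- \<delta>\<^sup>2 / 4\<close>. The slack \<open>2 * pi\<close> then costs the factor
    \<open>exp (\<delta> * pi)\<close>, at most \<open>exp pi\<close>.\<close>
  define l where "l = \<delta> / 2"
  have l: "0 \<le> l" "l \<le> 1" using \<delta> by (auto simp: l_def)
  let ?L = "large_dev N \<delta> \<phi> n"
  have "real (card ?L) * exp (l * (\<delta> * real n - 2 * pi))
      = (\<Sum>j\<in>?L. exp (l * (\<delta> * real n - 2 * pi)))"
    by simp
  also have "\<dots> \<le> (\<Sum>j\<in>?L. exp (l * cos_sum N \<phi> n (real j / real N ^ n)))"
    using l by (intro sum_mono) (auto simp: large_dev_def intro!: mult_left_mono)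
  also have "\<dots> \<le> (\<Sum>j<N ^ n. exp (l * cos_sum N \<phi> n (real j / real N ^ n)))"
    by (intro sum_mono2) (auto simp: large_dev_def)
  also have "\<dots> \<le> (real N * (1 + l\<^sup>2)) ^ n"
    by (rule sum_exp_cos_sum_le[OF N l])
  also have "\<dots> \<le> (real N * exp (l\<^sup>2)) ^ n"
    by (intro power_mono mult_left_mono) auto
  also have "\<dots> = real N ^ n * exp (l\<^sup>2 * real n)"
    by (simp add: power_mult_distrib exp_of_nat_mult[symmetric] mult.commute)
  finally have "real (card ?L) \<le> real N ^ n * exp (l\<^sup>2 * real n) / exp (l * (\<delta> * real n - 2 * pi))"
    by (simp add: pos_le_divide_eq)
  also have "\<dots> = real N ^ n * (exp (\<delta> * pi) * exp (- (\<delta>\<^sup>2 / 4) * real n))"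
    unfolding exp_add[symmetric] times_divide_eq_right[symmetric] exp_diff[symmetric]
    by (simp add: l_def power2_eq_square field_simps)
  also have "\<dots> \<le> real N ^ n * (exp pi * exp (- (\<delta>\<^sup>2 / 4) * real n))"
    using \<delta> by (intro mult_left_mono mult_right_mono) auto
  finally show ?thesis by (simp add: mult_ac)
qed

subsection \<open>A peaked trigonometric polynomial\<close>

text \<open>Euler's formula followed by the binomial theorem; the exponents \<open>k\<close> and
  \<open>2 * m - k\<close> of opposite sign combine to \<open>2 * (k - m)\<close>.\<close>

lemma cos_even_power_eq_sum_cis:
  "complex_of_real (cos x ^ (2 * m))
    = (\<Sum>k\<le>2 * m. complex_of_real (real (2 * m choose k) / 4 ^ m) * cis (2 * (real k - real m) * x))"
proof -
  have "complex_of_real (cos x) = (cis x + cis (- x)) / 2"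
    by (simp add: complex_eq_iff)
  then have "complex_of_real (cos x ^ (2 * m)) = (cis x + cis (- x)) ^ (2 * m) / 4 ^ m"
    by (simp only: of_real_power power_divide) (simp add: power_mult)
  also have "(cis x + cis (- x)) ^ (2 * m)
      = (\<Sum>k\<le>2 * m. of_nat (2 * m choose k) * cis x ^ k * cis (- x) ^ (2 * m - k))"
    by (rule binomial_ring)
  also have "\<dots> = (\<Sum>k\<le>2 * m. of_nat (2 * m choose k) * cis (2 * (real k - real m) * x))"
  proof (rule sum.cong)
    fix k assume "k \<in> {..2 * m}"
    then have "real k * x + real (2 * m - k) * (- x) = 2 * (real k - real m) * x"
      by (simp add: of_nat_diff algebra_simps)
    then show "of_nat (2 * m choose k) * cis x ^ k * cis (- x) ^ (2 * m - k)
        = of_nat (2 * m choose k) * cis (2 * (real k - real m) * x)"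
      by (simp only: Complex.DeMoivre mult.assoc cis_mult)
  qed simp
  finally show ?thesis
    by (simp add: sum_divide_distrib)
qed

lemma prod_cis: "finite A \<Longrightarrow> (\<Prod>i\<in>A. cis (f i)) = cis (\<Sum>i\<in>A. f i)"
  by (induction A rule: finite_induct) (auto simp: cis_mult)

text \<open>The even exponent makes every factor nonnegative and of period 1, although
  \<open>cos (pi * t)\<close> itself changes sign under integer shifts. The peaks are the integer
  vectors.\<close>

definition bump :: "nat \<Rightarrow> real ^ 'n \<Rightarrow> real" where
  "bump m x = (\<Prod>i\<in>UNIV. cos (pi * x $ i) ^ (2 * m))"

text \<open>Frequencies are stored as binomial indices, shifted by \<open>m\<close>: the range from
  \<open>-m\<close> to \<open>m\<close> becomes \<open>{..2 * m}\<close>, and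
  \<open>freq_vec\<close> undoes the shift. The constant function \<open>m\<close> encodes frequency
  zero.\<close>

definition bump_freqs :: "nat \<Rightarrow> ('n::finite \<Rightarrow> nat) set" where
  "bump_freqs m = (UNIV \<rightarrow>\<^sub>E {..2 * m})"

definition bump_coeff :: "nat \<Rightarrow> ('n::finite \<Rightarrow> nat) \<Rightarrow> real" where
  "bump_coeff m \<kappa> = (\<Prod>i\<in>UNIV. real (2 * m choose \<kappa> i) / 4 ^ m)"

definition freq_vec :: "nat \<Rightarrow> ('n::finite \<Rightarrow> nat) \<Rightarrow> real ^ 'n" where
  "freq_vec m \<kappa> = (\<chi> i. real (\<kappa> i) - real m)"

lemma finite_bump_freqs: "finite (bump_freqs m :: ('n::finite \<Rightarrow> nat) set)"
  unfolding bump_freqs_def by (intro finite_PiE) auto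

lemma bump_coeff_nonneg: "bump_coeff m \<kappa> \<ge> 0"
  unfolding bump_coeff_def by (intro prod_nonneg) auto

text \<open>Multiplying out the one-dimensional expansions gives one character for each choice of
  indices; as the coefficients are real, taking real parts leaves cosines.\<close>

lemma bump_fourier:
  fixes x :: "real ^ 'n"
  shows "bump m x = (\<Sum>\<kappa>\<in>bump_freqs m. bump_coeff m \<kappa> * cos (2 * pi * (freq_vec m \<kappa> \<bullet> x)))"
proof -
  have "complex_of_real (bump m x)
      = (\<Prod>i\<in>UNIV. \<Sum>k\<le>2 * m. complex_of_real (real (2 * m choose k) / 4 ^ m)
          * cis (2 * (real k - real m) * (pi * x $ i)))"
    unfolding bump_def of_real_prod cos_even_power_eq_sum_cis ..
  also have "\<dots> = (\<Sum>\<kappa>\<in>bump_freqs m. \<Prod>i\<in>UNIV. complex_of_real (real (2 * m choose \<kappa> i) / 4 ^ m)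
          * cis (2 * (real (\<kappa> i) - real m) * (pi * x $ i)))"
    unfolding bump_freqs_def by (rule prod_sum_PiE) auto
  also have "\<dots> = (\<Sum>\<kappa>\<in>bump_freqs m. complex_of_real (bump_coeff m \<kappa>)
          * cis (2 * pi * (freq_vec m \<kappa> \<bullet> x)))"
    by (intro sum.cong refl)
      (simp add: prod.distrib prod_cis bump_coeff_def freq_vec_def inner_vec_def sum_distrib_left
        mult_ac del: of_real_divide of_real_of_nat_eq)
  finally have "Re (complex_of_real (bump m x)) = Re \<dots>"
    by (rule arg_cong)
  then show ?thesis
    by (simp add: Re_sum)
qed

lemma sum_bump_coeff: "(\<Sum>\<kappa>\<in>bump_freqs m. bump_coeff m (\<kappa> :: 'n::finite \<Rightarrow> nat)) = 1"
  using bump_fourier[of m "0 :: real ^ 'n"] by (simp add: bump_def)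

lemma bump_torus_cong:
  assumes "torus_cong x y" shows "bump m (x - a) = bump m (y - a)"
proof -
  have "cos (pi * (x - a) $ i) ^ (2 * m) = cos (pi * (y - a) $ i) ^ (2 * m)" for i
  proof -
    obtain l where "x $ i - y $ i = of_int l"
      using assms unfolding torus_cong_def by (meson Ints_cases)
    then have "pi * (x - a) $ i = pi * of_int l + pi * (y - a) $ i"
      by (simp flip: distrib_left)
    moreover have "(sin (pi * of_int l))\<^sup>2 = 0"
      by (simp add: sin_zero_iff_int2 mult.commute)
    ultimately have "(cos (pi * (x - a) $ i))\<^sup>2 = (cos (pi * (y - a) $ i))\<^sup>2"
      by (simp add: cos_add power_mult_distrib cos_squared_eq)
    then show ?thesis by (simp only: power_mult)
  qed
  then show ?thesis unfolding bump_def by simp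
qed

text \<open>One coordinate away from the integers suffices: its factor is small and all others are
  at most 1.\<close>

lemma bump_le:
  fixes x :: "real ^ 'n"
  assumes "0 \<le> \<rho>" "\<rho> \<le> 1 / 2" "\<rho> \<le> \<bar>x $ i\<bar>" "\<bar>x $ i\<bar> \<le> 1 - \<rho>"
  shows "bump m x \<le> ((cos (pi * \<rho>))\<^sup>2) ^ m"
proof -
  have "\<bar>cos (pi * \<bar>x $ i\<bar>)\<bar> \<le> cos (pi * \<rho>)"
  proof -
    have "cos (pi * \<bar>x $ i\<bar>) \<le> cos (pi * \<rho>)"
      using assms by (intro cos_monotone_0_pi_le) (auto simp: mult_left_le)
    \<comment> \<open>Reflection in \<open>pi / 2\<close> bounds the cosine from below, where it may
      be close to -1.\<close>
    moreover have "cos (pi - pi * \<bar>x $ i\<bar>) \<le> cos (pi * \<rho>)"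
      using assms mult_left_mono[of "\<bar>x $ i\<bar>" "1 - \<rho>" pi]
      by (intro cos_monotone_0_pi_le) (auto simp: algebra_simps)
    ultimately show ?thesis by (simp add: cos_diff)
  qed
  then have "\<bar>cos (pi * x $ i)\<bar> \<le> cos (pi * \<rho>)"
    by (simp add: abs_if split: if_splits)
  then have "\<bar>cos (pi * x $ i)\<bar>\<^sup>2 \<le> (cos (pi * \<rho>))\<^sup>2"
    by (rule power_mono) simp
  then have c: "(cos (pi * x $ i))\<^sup>2 \<le> (cos (pi * \<rho>))\<^sup>2"
    by simp
  have "bump m x = cos (pi * x $ i) ^ (2 * m) * (\<Prod>j\<in>UNIV - {i}. cos (pi * x $ j) ^ (2 * m))"
    unfolding bump_def by (rule prod.remove) auto
  also have "\<dots> \<le> ((cos (pi * x $ i))\<^sup>2) ^ m * 1"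
    unfolding power_mult
    by (intro mult_left_mono prod_le_1) (auto simp: power_le_one abs_square_le_1)
  also have "\<dots> \<le> ((cos (pi * \<rho>))\<^sup>2) ^ m"
    using c by (simp add: power_mono)
  finally show ?thesis .
qed

text \<open>The right-hand side is the mean of the bump. By the lower bound for central binomial
  coefficients it decays only polynomially in \<open>m\<close>, like a power of
  \<open>1 / (2 * m)\<close>, and so eventually beats the geometric decay on the left.\<close>

lemma ex_bump_coeff_dominates:
  fixes \<theta> :: real assumes "0 \<le> \<theta>" "\<theta> < 1"
  shows "\<exists>m. \<theta> ^ m < bump_coeff m (\<lambda>_::'n::finite. m)"
proof -
  define d where "d = CARD('n)"
  have "d > 0" by (simp add: d_def)
  define \<eta> where "\<eta> = root d \<theta>"
  have \<eta>: "0 \<le> \<eta>" "\<eta> < 1" "\<eta> ^ d = \<theta>"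
    using assms \<open>d > 0\<close> by (auto simp: \<eta>_def real_root_pow_pos2)
  have "(\<lambda>m. of_nat m * \<eta> ^ m) \<longlonglongrightarrow> 0"
    using \<eta> by (intro powser_times_n_limit_0) auto
  then have "\<forall>\<^sub>F m in sequentially. real m * \<eta> ^ m < 1 / 2"
    by (rule order_tendstoD) auto
  then have "\<forall>\<^sub>F m in sequentially. real m * \<eta> ^ m < 1 / 2 \<and> m \<ge> 1"
    using eventually_ge_at_top by (rule eventually_conj)
  then obtain m where m: "real m * \<eta> ^ m < 1 / 2" "m \<ge> 1"
    by (metis (no_types, lifting) eventually_at_top_linorder order_refl)
  have "\<theta> ^ m = (\<eta> ^ m) ^ d"
    using \<eta>(3) by (metis power_mult mult.commute)
  also have "\<dots> < (1 / (2 * real m)) ^ d"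
    using m \<eta> \<open>d > 0\<close> by (intro power_strict_mono) (auto simp: field_simps)
  also have "\<dots> \<le> (real (2 * m choose m) / 4 ^ m) ^ d"
    using m central_binomial_lower_bound[of m] by (intro power_mono) (auto simp: field_simps)
  also have "\<dots> = bump_coeff m (\<lambda>_::'n. m)"
    by (simp add: bump_coeff_def d_def)
  finally show ?thesis by blast
qed

section \<open>Orbits in \<open>K\<close> and biased frequencies\<close>

lemma torus_invariant_orbit:
  assumes "torus_invariant N K" "x \<in> K"
  shows "\<exists>y\<in>K. torus_cong y (real N ^ k *\<^sub>R x)"
proof (induction k)
  case 0
  then show ?case using assms(2) by (auto simp: torus_cong_def intro!: bexI[of _ x])
next
  case (Suc k)
  then obtain y where y: "y \<in> K" "torus_cong y (real N ^ k *\<^sub>R x)" by blast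
  then obtain z where z: "z \<in> K" "torus_cong z (real N *\<^sub>R y)"
    using assms(1) unfolding torus_invariant_def torus_cong_torus_map by blast
  have "z $ i - (real N ^ Suc k *\<^sub>R x) $ i \<in> \<int>" for i
  proof -
    have "z $ i - (real N ^ Suc k *\<^sub>R x) $ i
        = (z $ i - (real N *\<^sub>R y) $ i) + of_nat N * (y $ i - (real N ^ k *\<^sub>R x) $ i)"
      by (simp add: algebra_simps)
    also have "\<dots> \<in> \<int>"
      using y z unfolding torus_cong_def by (intro Ints_add Ints_mult Ints_of_nat) auto
    finally show ?thesis .
  qed
  then show ?case using z(1) unfolding torus_cong_def by blast
qed

text \<open>A closed proper subset of the cube misses a point of the open cube, which is dense in
  it. The upper bound \<open>1 - \<rho>\<close> also keeps the coordinate difference away from 1 and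
  -1, so the avoidance holds modulo integer vectors.\<close>

lemma ex_cube_avoiding_closed:
  fixes K :: "(real ^ 'n) set"
  assumes "closed K" "K \<subset> cbox 0 1"
  obtains a \<rho> where "0 < \<rho>" "\<rho> \<le> 1 / 2"
    "\<And>y. y \<in> K \<Longrightarrow> \<exists>i. \<rho> \<le> \<bar>(y - a) $ i\<bar> \<and> \<bar>(y - a) $ i\<bar> \<le> 1 - \<rho>"
proof -
  have "box 0 1 - K \<noteq> {}"
  proof
    assume "box 0 1 - K = {}"
    then have "closure (box 0 1 :: (real ^ 'n) set) \<subseteq> K"
      using assms(1) by (intro closure_minimal) auto
    moreover have "box 0 (1 :: real ^ 'n) \<noteq> {}"
      by (simp add: interval_ne_empty_cart)
    ultimately show False using assms(2) by auto
  qed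
  then obtain a where a: "a \<in> box 0 1 - K" by blast
  have "open (box 0 1 - K)"
    using assms(1) by (intro open_Diff open_box)
  then obtain e where e: "e > 0" "ball a e \<subseteq> box 0 1 - K"
    using a by (meson open_contains_ball)
  define d where "d = real CARD('n)"
  have d: "d \<ge> 1" by (simp add: d_def Suc_leI)
  define \<rho> where "\<rho> = min (1 / 2) (e / (2 * d))"
  have \<rho>: "0 < \<rho>" "\<rho> \<le> 1 / 2" "d * \<rho> < e"
    using e d by (auto simp: \<rho>_def field_simps min_def)
  have near: "y \<in> ball a e" if "\<And>i. \<bar>(y - a) $ i\<bar> \<le> \<rho>" for y
  proof -
    have "norm (y - a) \<le> (\<Sum>i\<in>UNIV. \<bar>(y - a) $ i\<bar>)"
      by (rule norm_le_l1_cart)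
    also have "\<dots> \<le> (\<Sum>i\<in>(UNIV :: 'n set). \<rho>)"
      using that by (intro sum_mono)
    also have "\<dots> < e" using \<rho> by (simp add: d_def)
    finally show ?thesis by (simp add: dist_norm norm_minus_commute)
  qed
  \<comment> \<open>The small cube around \<open>a\<close> lies in the open unit cube, so
    \<open>a\<close> is at distance at least \<open>\<rho>\<close> from every face; this yields the
    upper bound \<open>1 - \<rho>\<close>.\<close>
  have corner: "\<rho> \<le> a $ i \<and> a $ i \<le> 1 - \<rho>" for i
  proof -
    have "a + s *\<^sub>R axis i 1 \<in> box 0 1" if "\<bar>s\<bar> = \<rho>" for s
    proof -
      have "a + s *\<^sub>R axis i 1 \<in> ball a e"
        using that \<rho> by (intro near) (auto simp: axis_def)
      then show ?thesis using e by blast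
    qed
    from this[of \<rho>] this[of "- \<rho>"] have "(a + \<rho> *\<^sub>R axis i 1) $ i < 1" "0 < (a + (- \<rho>) *\<^sub>R axis i 1) $ i"
      using \<rho> by (simp_all only: mem_box_cart zero_index one_index abs_minus_cancel abs_of_pos)
    then show ?thesis by (simp add: axis_def)
  qed
  have "\<exists>i. \<rho> \<le> \<bar>(y - a) $ i\<bar> \<and> \<bar>(y - a) $ i\<bar> \<le> 1 - \<rho>" if "y \<in> K" for y
  proof -
    have "y \<notin> ball a e" using e that by blast
    then obtain i where i: "\<not> \<bar>(y - a) $ i\<bar> \<le> \<rho>" using near by blast
    moreover have "0 \<le> y $ i" "y $ i \<le> 1"
      using that assms(2) by (auto simp: mem_box_cart)
    ultimately show ?thesis
      using corner[of i] by (intro exI[of _ i]) auto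
  qed
  then show ?thesis using that \<rho> by blast
qed

text \<open>The bump centred at \<open>a\<close> is at most \<open>\<theta> ^ m\<close> along the
  orbit, below its mean. The coefficients being nonnegative with sum 1, this deficit forces a
  negative bias of order \<open>\<delta>\<close> at some nonzero frequency.\<close>

lemma ex_large_cos_sum:
  fixes K :: "(real ^ 'n) set"
  assumes "closed K" "K \<subset> cbox 0 1" "torus_invariant N K"
  obtains V :: "((real ^ 'n) \<times> real) set" and \<delta> where "finite V" "0 < \<delta>" "\<delta> \<le> 1"
    "\<And>v \<phi>. (v, \<phi>) \<in> V \<Longrightarrow> v \<noteq> 0 \<and> (\<forall>i. v $ i \<in> \<int>)"
    "\<And>x n. x \<in> K \<Longrightarrow> n > 0 \<Longrightarrow> \<exists>(v, \<phi>)\<in>V. \<delta> * real n \<le> cos_sum N \<phi> n (v \<bullet> x)"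
proof -
  obtain a \<rho> where \<rho>: "0 < \<rho>" "\<rho> \<le> 1 / 2"
    and avoid: "\<And>y. y \<in> K \<Longrightarrow> \<exists>i. \<rho> \<le> \<bar>(y - a) $ i\<bar> \<and> \<bar>(y - a) $ i\<bar> \<le> 1 - \<rho>"
    using ex_cube_avoiding_closed[OF assms(1,2)] by metis
  define \<theta> where "\<theta> = (cos (pi * \<rho>))\<^sup>2"
  have "0 < sin (pi * \<rho>)"
    using \<rho> by (intro sin_gt_zero) (auto simp: field_simps)
  then have "\<theta> < 1"
    by (simp add: \<theta>_def cos_squared_eq)
  have "0 \<le> \<theta>"
    by (simp add: \<theta>_def)
  note \<theta> = this \<open>\<theta> < 1\<close>
  obtain m where m: "\<theta> ^ m < bump_coeff m (\<lambda>_::'n. m)"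
    using ex_bump_coeff_dominates[OF \<theta>] by blast
  define \<kappa>0 :: "'n \<Rightarrow> nat" where "\<kappa>0 = (\<lambda>_. m)"
  have \<kappa>0: "\<kappa>0 \<in> bump_freqs m" "freq_vec m \<kappa>0 = 0"
    by (auto simp: \<kappa>0_def bump_freqs_def freq_vec_def vec_eq_iff)
  define F where "F = bump_freqs m - {\<kappa>0}"
  \<comment> \<open>The phase combines the translation by \<open>a\<close> with a half period that
    makes the negative bias positive.\<close>
  define V where "V = (\<lambda>\<kappa>. (freq_vec m \<kappa>, pi - 2 * pi * (freq_vec m \<kappa> \<bullet> a))) ` F"
  define \<delta> where "\<delta> = bump_coeff m \<kappa>0 - \<theta> ^ m"
  have F: "finite F" "(\<Sum>\<kappa>\<in>F. bump_coeff m \<kappa>) = 1 - bump_coeff m \<kappa>0"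
    using finite_bump_freqs[where 'n = 'n] sum_bump_coeff[of m, where 'n = 'n] \<kappa>0
    by (auto simp: F_def sum_diff1)
  have F1: "(\<Sum>\<kappa>\<in>F. bump_coeff m \<kappa>) \<le> 1" "bump_coeff m \<kappa>0 \<le> 1"
  proof -
    have "0 \<le> (\<Sum>\<kappa>\<in>F. bump_coeff m \<kappa>)"
      by (intro sum_nonneg bump_coeff_nonneg)
    then show "(\<Sum>\<kappa>\<in>F. bump_coeff m \<kappa>) \<le> 1" "bump_coeff m \<kappa>0 \<le> 1"
      using F(2) bump_coeff_nonneg[of m \<kappa>0] by linarith+
  qed
  have \<delta>: "0 < \<delta>" "\<delta> \<le> 1"
    using m F1 \<theta> zero_le_power[of \<theta> m] unfolding \<delta>_def \<kappa>0_def by linarith+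
  have V: "v \<noteq> 0 \<and> (\<forall>i. v $ i \<in> \<int>)" if "(v, \<phi>) \<in> V" for v \<phi>
  proof -
    from that obtain \<kappa> where \<kappa>: "\<kappa> \<noteq> \<kappa>0" "v = freq_vec m \<kappa>"
      by (auto simp: V_def F_def)
    then obtain i where "\<kappa> i \<noteq> m" by (auto simp: \<kappa>0_def)
    then have "v $ i \<noteq> 0" using \<kappa> by (simp add: freq_vec_def)
    then have "v \<noteq> 0" by auto
    then show ?thesis using \<kappa> by (simp add: freq_vec_def)
  qed
  have "\<exists>(v, \<phi>)\<in>V. \<delta> * real n \<le> cos_sum N \<phi> n (v \<bullet> x)" if x: "x \<in> K" and n: "n > 0" for x n
  proof (rule ccontr)
    define S where "S \<kappa> = (\<Sum>k<n. cos (2 * pi * (freq_vec m \<kappa> \<bullet> (real N ^ k *\<^sub>R x - a))))" for \<kappa>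
    assume "\<not> ?thesis"
    then have none: "cos_sum N (pi - 2 * pi * (freq_vec m \<kappa> \<bullet> a)) n (freq_vec m \<kappa> \<bullet> x) < \<delta> * real n"
      if "\<kappa> \<in> F" for \<kappa> using that by (fastforce simp: V_def)
    have S: "S \<kappa> > - (\<delta> * real n)" if "\<kappa> \<in> F" for \<kappa>
    proof -
      have "S \<kappa> = cos_sum N (- (2 * pi * (freq_vec m \<kappa> \<bullet> a))) n (freq_vec m \<kappa> \<bullet> x)"
        unfolding S_def cos_sum_def by (simp add: inner_diff_right right_diff_distrib)
      then show ?thesis
        using none[OF that] cos_sum_pi[of N "- (2 * pi * (freq_vec m \<kappa> \<bullet> a))" n] by simp
    qed
    have le: "bump m (real N ^ k *\<^sub>R x - a) \<le> \<theta> ^ m" for k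
    proof -
      obtain y where "y \<in> K" "torus_cong y (real N ^ k *\<^sub>R x)"
        using torus_invariant_orbit[OF assms(3) x] by blast
      then show ?thesis
        using avoid[OF \<open>y \<in> K\<close>] bump_torus_cong[of y _ m a] bump_le[of \<rho> "y - a" _ m] \<rho>
        by (auto simp: \<theta>_def)
    qed
    have "(\<Sum>k<n. bump m (real N ^ k *\<^sub>R x - a)) = (\<Sum>\<kappa>\<in>bump_freqs m. bump_coeff m \<kappa> * S \<kappa>)"
      unfolding bump_fourier S_def sum_distrib_left by (rule sum.swap)
    also have "\<dots> = bump_coeff m \<kappa>0 * real n + (\<Sum>\<kappa>\<in>F. bump_coeff m \<kappa> * S \<kappa>)"
      unfolding F_def using \<kappa>0 finite_bump_freqs by (subst sum.remove[of _ \<kappa>0]) (auto simp: S_def)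
    finally have eq: "(\<Sum>k<n. bump m (real N ^ k *\<^sub>R x - a))
      = bump_coeff m \<kappa>0 * real n + (\<Sum>\<kappa>\<in>F. bump_coeff m \<kappa> * S \<kappa>)" .
    have "(\<Sum>k<n. bump m (real N ^ k *\<^sub>R x - a)) \<le> (\<Sum>k<n. \<theta> ^ m)"
      by (intro sum_mono le)
    moreover have "(\<Sum>\<kappa>\<in>F. bump_coeff m \<kappa> * S \<kappa>) \<ge> (\<Sum>\<kappa>\<in>F. bump_coeff m \<kappa> * (- (\<delta> * real n)))"
      using S by (intro sum_mono mult_left_mono bump_coeff_nonneg) (auto intro: less_imp_le)
    moreover have "(\<Sum>\<kappa>\<in>F. bump_coeff m \<kappa> * (- (\<delta> * real n)))
        = - ((1 - bump_coeff m \<kappa>0) * (\<delta> * real n))"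
      by (simp add: F sum_negf flip: sum_distrib_right)
    \<comment> \<open>The nonzero frequencies have total weight strictly below 1, so together they
      cannot account for a deficit of \<open>\<delta> * n\<close>.\<close>
    ultimately have "\<delta> * real n \<le> (1 - bump_coeff m \<kappa>0) * (\<delta> * real n)"
      using eq by (simp add: \<delta>_def algebra_simps)
    moreover have "bump_coeff m \<kappa>0 * (\<delta> * real n) > 0"
    proof -
      have "0 < bump_coeff m \<kappa>0"
        using m zero_le_power[OF \<theta>(1), of m] unfolding \<kappa>0_def by linarith
      then show ?thesis using n \<delta> by simp
    qed
    ultimately show False by (simp add: algebra_simps)
  qed
  then show ?thesis
    using that[of V \<delta>] V \<delta> F(1) by (auto simp: V_def)
qed

subsection \<open>From slabs to tubes\<close>

text \<open>Covers arise as finite sets, but the conclusions speak of families indexed by naturals;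
  enumerating without repetition preserves the count.\<close>

lemma finite_family_nat_indexed:
  fixes \<A> :: "'a set"
  assumes "finite \<A>"
  obtains I :: "nat set" and A :: "nat \<Rightarrow> 'a" where "finite I" "A ` I = \<A>" "card I = card \<A>"
proof -
  obtain h where "bij_betw h {0..<card \<A>} \<A>"
    using ex_bij_betw_nat_finite[OF assms] by blast
  then show ?thesis
    using that[of "{0..<card \<A>}" h] by (auto simp: bij_betw_def)
qed

lemma line_affine_hull_2: "a \<noteq> b \<Longrightarrow> line (affine hull {a, b})"
  unfolding line_def by simp

text \<open>The lines run parallel to the plane of two coordinates \<open>p, q\<close>, where \<open>v $ p\<close> is a largest
  coordinate of the normal vector \<open>v\<close>; the other \<open>d - 2\<close> coordinates are rounded to the grid \<open>r\<int>\<close>.\<close>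

lemma hyperplane_nbhd_cover_lines:
  fixes H :: "(real ^ 'n) set"
  assumes d: "CARD('n) \<ge> 2" and H: "hyperplane H" and r: "0 < r" "r \<le> 1"
  obtains \<L> where "finite \<L>" "\<And>L. L \<in> \<L> \<Longrightarrow> line L"
    "real (card \<L>) \<le> (2 / r) ^ (CARD('n) - 2)"
    "nbhd H r \<inter> cbox 0 1 \<subseteq> (\<Union>L\<in>\<L>. nbhd L (4 * real CARD('n) * r))"
proof -
  let ?d = "real CARD('n)"
  have "affine H" "aff_dim H = int DIM(real ^ 'n) - 1"
    using H by (auto simp: hyperplane_def)
  then have "\<exists>v b. v \<noteq> 0 \<and> H = {x. v \<bullet> x = b}"
    using aff_dim_eq_hyperplane[of H] by (simp add: of_nat_diff hull_same)
  then obtain v b where v: "v \<noteq> 0" and Hv: "H = {x. v \<bullet> x = b}"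
    by auto
  define f where "f = (\<lambda>i. \<bar>v $ i\<bar>)"
  have "Max (range f) \<in> range f"
    by (rule Max_in) auto
  then obtain p where "Max (range f) = f p"
    by (rule rangeE)
  then have p: "\<bar>v $ i\<bar> \<le> \<bar>v $ p\<bar>" for i
    using Max_ge[of "range f" "f i"] by (simp add: f_def)
  have vp: "\<bar>v $ p\<bar> > 0"
  proof -
    obtain i where "v $ i \<noteq> 0"
      using v by (auto simp: vec_eq_iff)
    then show ?thesis
      using p[of i] by linarith
  qed
  have "UNIV \<noteq> {p}"
  proof
    assume "UNIV = {p}"
    then have "CARD('n) = card {p}" by (rule arg_cong)
    then show False using d by simp
  qed
  then obtain q where q: "q \<noteq> p"
    by blast
  define R where "R = UNIV - {p, q}"
  have split: "sum f UNIV = f p + f q + sum f R" for f :: "'n \<Rightarrow> real"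
    unfolding R_def using q by (simp add: sum_diff)
  define G where "G = (\<lambda>k. r * real k) ` {..nat \<lfloor>1 / r\<rfloor>}"
  \<comment> \<open>The point of \<open>H\<close> with coordinate 0 at \<open>q\<close> and the
    prescribed coordinates on \<open>R\<close>; the equation of \<open>H\<close> determines
    coordinate \<open>p\<close>.\<close>
  define z :: "('n \<Rightarrow> real) \<Rightarrow> real ^ 'n" where
    "z g = (\<chi> i. if i = q then 0 else if i = p then (b - (\<Sum>j\<in>R. v $ j * g j)) / v $ p else g i)" for g
  \<comment> \<open>A direction orthogonal to \<open>v\<close>, normalised at \<open>q\<close> so
    that the multiplier \<open>x $ q\<close> reaches the point with the same
    \<open>q\<close>-coordinate as \<open>x\<close>.\<close>
  define u :: "real ^ 'n" where "u = axis q 1 - (v $ q / v $ p) *\<^sub>R axis p 1"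
  define \<L> where "\<L> = (\<lambda>g. affine hull {z g, z g + u}) ` (PiE R (\<lambda>_. G))"
  have "finite G" by (simp add: G_def)
  have "u $ q = 1"
    using q by (simp add: u_def axis_def)
  then have "u \<noteq> 0" by auto
  show ?thesis
  proof (rule that[of \<L>])
    show "finite \<L>"
      unfolding \<L>_def using \<open>finite G\<close> by (intro finite_imageI finite_PiE) auto
    show "line L" if "L \<in> \<L>" for L
      using that \<open>u \<noteq> 0\<close> by (auto simp: \<L>_def intro!: line_affine_hull_2)
    have "real (card G) \<le> 2 / r"
    proof -
      have "card G \<le> nat \<lfloor>1 / r\<rfloor> + 1"
        unfolding G_def by (rule order_trans[OF card_image_le]) auto
      then have "real (card G) \<le> real (nat \<lfloor>1 / r\<rfloor>) + 1"
        by linarith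
      also have "\<dots> \<le> 1 / r + 1 / r"
        using r by (intro add_mono) auto
      finally show ?thesis by simp
    qed
    moreover have "real (card \<L>) \<le> real (card G) ^ (CARD('n) - 2)"
    proof -
      have "card \<L> \<le> card (PiE R (\<lambda>_. G))"
        unfolding \<L>_def using \<open>finite G\<close> by (intro card_image_le finite_PiE) auto
      also have "\<dots> = card G ^ card R"
        by (simp add: card_PiE)
      also have "card R = CARD('n) - 2"
        unfolding R_def using q by (simp add: card_Diff_subset)
      finally have "real (card \<L>) \<le> real (card G ^ (CARD('n) - 2))"
        by (rule of_nat_mono)
      then show ?thesis by simp
    qed
    ultimately show "real (card \<L>) \<le> (2 / r) ^ (CARD('n) - 2)"
      by (meson of_nat_0_le_iff order_trans power_mono)
    show "nbhd H r \<inter> cbox 0 1 \<subseteq> (\<Union>L\<in>\<L>. nbhd L (4 * ?d * r))"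
    proof
      fix x assume x: "x \<in> nbhd H r \<inter> cbox 0 1"
      then obtain h where h: "v \<bullet> h = b" "dist h x < r"
        by (auto simp: nbhd_def Hv)
      have xi: "0 \<le> x $ i" "x $ i \<le> 1" for i
        using x by (auto simp: mem_box_cart)
      have nv: "norm v \<le> ?d * \<bar>v $ p\<bar>"
        using norm_le_l1_cart[of v] sum_mono[of UNIV "\<lambda>i. \<bar>v $ i\<bar>" "\<lambda>_. \<bar>v $ p\<bar>"] p
        by simp
      have vx: "\<bar>v \<bullet> x - b\<bar> \<le> ?d * \<bar>v $ p\<bar> * r"
      proof -
        have "\<bar>v \<bullet> x - b\<bar> = \<bar>v \<bullet> (x - h)\<bar>"
          using h by (simp add: inner_diff_right)
        also have "\<dots> \<le> norm v * norm (x - h)"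
          by (rule Cauchy_Schwarz_ineq2)
        also have "\<dots> \<le> (?d * \<bar>v $ p\<bar>) * r"
          using h nv by (intro mult_mono) (auto simp: dist_norm norm_minus_commute)
        finally show ?thesis .
      qed
      define g where "g = restrict (\<lambda>i. r * real (nat \<lfloor>x $ i / r\<rfloor>)) R"
      have g: "g \<in> PiE R (\<lambda>_. G)"
      proof -
        have "nat \<lfloor>x $ i / r\<rfloor> \<in> {..nat \<lfloor>1 / r\<rfloor>}" for i
          using r xi[of i] by (auto intro!: nat_mono floor_mono divide_right_mono)
        then show ?thesis
          unfolding g_def G_def by (intro restrict_PiE_iff[THEN iffD2] ballI imageI)
      qed
      have gx: "\<bar>x $ i - g i\<bar> \<le> r" if "i \<in> R" for i
      proof -
        have "x $ i - g i = r * frac (x $ i / r)"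
          using that r xi[of i] by (simp add: g_def frac_def right_diff_distrib)
        then show ?thesis
          using r frac_lt_1[of "x $ i / r"] by (simp add: abs_mult mult_left_le)
      qed
      define y where "y = z g + (x $ q) *\<^sub>R u"
      have yL: "y \<in> affine hull {z g, z g + u}"
        by (auto simp: affine_hull_2_alt y_def)
      have yq: "y $ q = x $ q"
        using q by (simp add: y_def z_def u_def axis_def)
      have yR: "y $ i = g i" if "i \<in> R" for i
        using that by (auto simp: y_def z_def u_def axis_def R_def)
      have yp: "y $ p = (b - (\<Sum>j\<in>R. v $ j * g j) - v $ q * x $ q) / v $ p"
        using q by (simp add: y_def z_def u_def axis_def diff_divide_distrib)
      \<comment> \<open>The error at \<open>p\<close> collects the distance to \<open>H\<close> and
        the rounding errors on \<open>R\<close>. Maximality of \<open>v $ p\<close> keeps all of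
        them of order \<open>r\<close> after division.\<close>
      have "v $ p * (x $ p - y $ p) = (v \<bullet> x - b) - (\<Sum>j\<in>R. v $ j * (x $ j - g j))"
        using vp unfolding yp inner_vec_def
        by (simp add: split field_simps sum_subtractf)
      then have "\<bar>v $ p\<bar> * \<bar>x $ p - y $ p\<bar> \<le> \<bar>v \<bullet> x - b\<bar> + (\<Sum>j\<in>R. \<bar>v $ j * (x $ j - g j)\<bar>)"
        unfolding abs_mult[symmetric]
        by (auto intro!: order_trans[OF abs_triangle_ineq4] add_left_mono sum_abs)
      also have "\<dots> \<le> ?d * \<bar>v $ p\<bar> * r + (\<Sum>j\<in>R. \<bar>v $ p\<bar> * r)"
        using p gx by (intro add_mono vx sum_mono) (auto simp: abs_mult intro!: mult_mono)
      also have "(\<Sum>j\<in>R. \<bar>v $ p\<bar> * r) \<le> (\<Sum>j\<in>(UNIV :: 'n set). \<bar>v $ p\<bar> * r)"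
        using r by (intro sum_mono2) auto
      finally have "\<bar>v $ p\<bar> * \<bar>x $ p - y $ p\<bar> \<le> \<bar>v $ p\<bar> * (2 * ?d * r)"
        by (simp add: algebra_simps)
      then have xp: "\<bar>x $ p - y $ p\<bar> \<le> 2 * ?d * r"
        using vp by simp
      have "norm (x - y) \<le> (\<Sum>i\<in>UNIV. \<bar>(x - y) $ i\<bar>)"
        by (rule norm_le_l1_cart)
      also have "\<dots> = \<bar>x $ p - y $ p\<bar> + (\<Sum>i\<in>R. \<bar>x $ i - g i\<bar>)"
        by (simp add: split yq yR)
      also have "\<dots> \<le> 2 * ?d * r + (\<Sum>i\<in>R. r)"
        using gx by (intro add_mono xp sum_mono) auto
      also have "(\<Sum>i\<in>R. r) \<le> (\<Sum>i\<in>(UNIV :: 'n set). r)"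
        using r by (intro sum_mono2) auto
      finally have "norm (x - y) \<le> 3 * ?d * r"
        by (simp add: mult_ac)
      also have "\<dots> < 4 * ?d * r"
        using r by simp
      finally have "x \<in> nbhd (affine hull {z g, z g + u}) (4 * ?d * r)"
        using yL by (auto simp: nbhd_def dist_norm norm_minus_commute)
      then show "x \<in> (\<Union>L\<in>\<L>. nbhd L (4 * ?d * r))"
        using g unfolding \<L>_def by blast
    qed
  qed
qed

text \<open>Inside the cube a slab is covered by at most \<open>(2 / r) ^ (d - 2)\<close> tubes of
  cost \<open>(4 * d * r) ^ (d - 1)\<close> each. All but one power of \<open>r\<close> cancel, so a
  slab costs \<open>C * r\<close>.\<close>

lemma tube_null_if_hyperplane_covers:
  fixes K :: "(real ^ 'n) set"
  assumes d: "CARD('n) \<ge> 2" and K: "K \<subseteq> cbox 0 1"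
    and cover: "\<And>\<epsilon>. \<epsilon> > 0 \<Longrightarrow> \<exists>\<H> r. finite \<H> \<and> (\<forall>H\<in>\<H>. hyperplane H) \<and> 0 < r \<and> r \<le> 1 \<and>
      real (card \<H>) * r < \<epsilon> \<and> K \<subseteq> (\<Union>H\<in>\<H>. nbhd H r)"
  shows "tube_null K"
  unfolding tube_null_def
proof (intro allI impI)
  fix \<epsilon> :: real assume "\<epsilon> > 0"
  define d where "d = CARD('n)"
  define C where "C = 2 ^ (d - 2) * (4 * real d) ^ (d - 1)"
  have "C > 0" unfolding C_def d_def by simp
  have d1: "d - 1 = Suc (d - 2)" using assms(1) by (simp add: d_def)
  obtain \<H> r where \<H>: "finite \<H>" "\<And>H. H \<in> \<H> \<Longrightarrow> hyperplane H" and r: "0 < r" "r \<le> 1"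
    and small: "real (card \<H>) * r < \<epsilon> / C" and KH: "K \<subseteq> (\<Union>H\<in>\<H>. nbhd H r)"
    using cover[of "\<epsilon> / C"] \<open>\<epsilon> > 0\<close> \<open>C > 0\<close> by auto
  have "\<forall>H\<in>\<H>. \<exists>\<L>. finite \<L> \<and> (\<forall>L\<in>\<L>. line L) \<and> real (card \<L>) \<le> (2 / r) ^ (d - 2) \<and>
      nbhd H r \<inter> cbox 0 1 \<subseteq> (\<Union>L\<in>\<L>. nbhd L (4 * real d * r))"
    unfolding d_def by (metis \<H>(2) hyperplane_nbhd_cover_lines[OF assms(1) _ r])
  then obtain \<L> where \<L>: "\<And>H. H \<in> \<H> \<Longrightarrow> finite (\<L> H) \<and> (\<forall>L\<in>\<L> H. line L) \<and>
      real (card (\<L> H)) \<le> (2 / r) ^ (d - 2) \<and>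
      nbhd H r \<inter> cbox 0 1 \<subseteq> (\<Union>L\<in>\<L> H. nbhd L (4 * real d * r))"
    by metis
  have "finite (\<Union>H\<in>\<H>. \<L> H)" using \<H> \<L> by auto
  then obtain I and L :: "nat \<Rightarrow> (real ^ 'n) set" where I: "finite I" "L ` I = (\<Union>H\<in>\<H>. \<L> H)"
    "card I = card (\<Union>H\<in>\<H>. \<L> H)"
    by (rule finite_family_nat_indexed)
  have "real (card I) \<le> real (\<Sum>H\<in>\<H>. card (\<L> H))"
    unfolding I using card_UN_le[OF \<H>(1)] by (intro of_nat_mono)
  also have "\<dots> \<le> (\<Sum>H\<in>\<H>. (2 / r) ^ (d - 2))"
    unfolding of_nat_sum using \<L> by (intro sum_mono) blast
  finally have "real (card I) * (4 * real d * r) ^ (d - 1)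
      \<le> real (card \<H>) * (2 / r) ^ (d - 2) * (4 * real d * r) ^ (d - 1)"
    using r by (intro mult_right_mono) auto
  also have "\<dots> = C * (real (card \<H>) * r)"
    using r unfolding C_def d1 by (simp add: power_divide power_mult_distrib)
  also have "\<dots> < \<epsilon>"
    using small \<open>C > 0\<close> by (simp add: field_simps)
  finally have "(\<Sum>i\<in>I. (4 * real d * r) ^ (DIM(real ^ 'n) - 1)) < \<epsilon>"
    by (simp add: d_def)
  moreover have "K \<subseteq> (\<Union>i\<in>I. nbhd (L i) (4 * real d * r))"
  proof
    fix x assume "x \<in> K"
    then obtain H where "H \<in> \<H>" "x \<in> nbhd H r \<inter> cbox 0 1"
      using KH K by blast
    then obtain L' where "L' \<in> \<L> H" "x \<in> nbhd L' (4 * real d * r)"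
      using \<L> by blast
    moreover from this obtain i where "i \<in> I" "L i = L'"
      using I(2) \<open>H \<in> \<H>\<close> by (metis UN_I imageE)
    ultimately show "x \<in> (\<Union>i\<in>I. nbhd (L i) (4 * real d * r))" by blast
  qed
  moreover have "\<forall>i\<in>I. line (L i)"
    using I(2) \<L> by blast
  moreover have "0 < 4 * real d * r"
    using r by (simp add: d_def)
  ultimately show "\<exists>(I :: nat set) L (w :: nat \<Rightarrow> real). (\<forall>i\<in>I. line (L i) \<and> w i > 0) \<and>
      K \<subseteq> (\<Union>i\<in>I. nbhd (L i) (w i)) \<and>
      (\<lambda>i. w i ^ (DIM(real ^ 'n) - 1)) summable_on I \<and>
      (\<Sum>\<^sub>\<infinity>i\<in>I. w i ^ (DIM(real ^ 'n) - 1)) < \<epsilon>"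
    using I(1) by (intro exI[of _ I] exI[of _ L] exI[of _ "\<lambda>_. 4 * real d * r"])
      (simp add: summable_on_finite infsum_finite)
qed

subsection \<open>Covering by slabs\<close>

lemma near_hyperplane:
  fixes x v :: "real ^ 'n"
  assumes "1 \<le> norm v" "\<bar>v \<bullet> x - b\<bar> < r"
  shows "x \<in> nbhd {y. v \<bullet> y = b} r"
proof -
  \<comment> \<open>The orthogonal projection of \<open>x\<close> to the hyperplane.\<close>
  define y where "y = x + ((b - v \<bullet> x) / (v \<bullet> v)) *\<^sub>R v"
  have v: "v \<noteq> 0" using assms(1) by auto
  then have "v \<bullet> y = b"
    by (simp add: y_def inner_add_right)
  moreover have "dist y x < r"
  proof -
    have "dist y x = \<bar>v \<bullet> x - b\<bar> / norm v"
      using v by (simp add: y_def dist_norm abs_minus_commute dot_square_norm power2_eq_square)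
    also have "\<dots> \<le> \<bar>v \<bullet> x - b\<bar>"
      using assms(1) v by (simp add: divide_le_eq mult_le_cancel_left1)
    finally show ?thesis using assms(2) by simp
  qed
  ultimately show ?thesis unfolding nbhd_def by auto
qed

lemma one_le_norm_integer_vector:
  fixes v :: "real ^ 'n"
  assumes "v \<noteq> 0" "\<And>i. v $ i \<in> \<int>" shows "1 \<le> norm v"
proof -
  obtain i where "v $ i \<noteq> 0" using assms(1) by (auto simp: vec_eq_iff)
  then have "1 \<le> \<bar>v $ i\<bar>" using assms(2) by (intro Ints_nonzero_abs_ge1) auto
  also have "\<dots> \<le> norm v" by (rule component_le_norm_cart)
  finally show ?thesis .
qed

text \<open>The integer part of \<open>t\<close> does not affect the sum, and rounding the
  fractional part down to the grid changes it by at most \<open>2 * pi\<close>, the slack built into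
  \<open>large_dev\<close>.\<close>

lemma large_dev_approx:
  assumes N: "N \<ge> 2" and t: "\<delta> * real n \<le> cos_sum N \<phi> n t"
  shows "\<exists>j\<in>large_dev N \<delta> \<phi> n. \<bar>t - (of_int \<lfloor>t\<rfloor> + real j / real N ^ n)\<bar> \<le> 1 / real N ^ n"
proof -
  have Nn: "real N ^ n > 0" using N by simp
  define m where "m = \<lfloor>real N ^ n * frac t\<rfloor>"
  define j where "j = nat m"
  have "m \<ge> 0" by (simp add: m_def)
  then have j: "real j \<le> real N ^ n * frac t" "real N ^ n * frac t < real j + 1"
    by (simp_all add: j_def m_def)
  have "real N ^ n * frac t < real N ^ n"
    using Nn frac_lt_1[of t] by simp
  then have "real j < real N ^ n" using j by linarith
  then have "j < N ^ n" by (metis of_nat_less_iff of_nat_power)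
  have near: "\<bar>frac t - real j / real N ^ n\<bar> \<le> 1 / real N ^ n"
  proof -
    have "frac t - real j / real N ^ n = (real N ^ n * frac t - real j) / real N ^ n"
      using Nn by (simp add: diff_divide_distrib)
    also have "\<bar>\<dots>\<bar> \<le> 1 / real N ^ n"
      using j Nn by (simp add: divide_right_mono)
    finally show ?thesis .
  qed
  have "cos_sum N \<phi> n t = cos_sum N \<phi> n (frac t)"
    using cos_sum_add_int[of N \<phi> n "\<lfloor>t\<rfloor>" "frac t"] by (simp add: frac_def)
  then have "\<delta> * real n - 2 * pi \<le> cos_sum N \<phi> n (real j / real N ^ n)"
    using t cos_sum_diff_le[OF N near, of \<phi>] by linarith
  then have "j \<in> large_dev N \<delta> \<phi> n"
    using \<open>j < N ^ n\<close> by (simp add: large_dev_def)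
  then show ?thesis
    using near by (intro bexI[of _ j]) (auto simp: frac_def algebra_simps)
qed

text \<open>At scale \<open>1 / N ^ n\<close> there are at most a constant times
  \<open>N ^ n * exp (- 2 * a * n)\<close> slabs, each of cost at most a constant times
  \<open>N powr (- c * n)\<close>, that is \<open>exp (a * n) / N ^ n\<close>. The total is of order
  \<open>exp (- a * n)\<close>.\<close>

lemma ex_small_hyperplane_cover:
  fixes K :: "(real ^ 'n) set"
  assumes N: "N \<ge> 2" and K: "closed K" "K \<subset> cbox 0 1" "torus_invariant N K"
  obtains c :: real where "0 < c" "c < 1"
    "\<And>\<epsilon>. \<epsilon> > 0 \<Longrightarrow> \<exists>\<H> r. finite \<H> \<and> (\<forall>H\<in>\<H>. hyperplane H) \<and> 0 < r \<and> r \<le> 1 \<and>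
      real (card \<H>) * r powr c < \<epsilon> \<and> K \<subseteq> (\<Union>H\<in>\<H>. nbhd H r)"
proof -
  obtain V :: "((real ^ 'n) \<times> real) set" and \<delta> where V: "finite V" and \<delta>: "0 < \<delta>" "\<delta> \<le> 1"
    and int: "\<And>v \<phi>. (v, \<phi>) \<in> V \<Longrightarrow> v \<noteq> 0 \<and> (\<forall>i. v $ i \<in> \<int>)"
    and large: "\<And>x n. x \<in> K \<Longrightarrow> n > 0 \<Longrightarrow> \<exists>(v, \<phi>)\<in>V. \<delta> * real n \<le> cos_sum N \<phi> n (v \<bullet> x)"
    using ex_large_cos_sum[OF K] by metis
  have lnN: "ln (real N) \<ge> 2 / 3"
  proof -
    have "ln 2 \<le> ln (real N)" using N by simp
    then show ?thesis using ln2_ge_two_thirds by linarith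
  qed
  \<comment> \<open>Half of the large deviation rate: one half pays for lowering the exponent from 1
    to \<open>c\<close>, the other makes the total cost tend to 0.\<close>
  define a where "a = \<delta>\<^sup>2 / 8"
  have a: "0 < a" "a \<le> 1 / 8"
    using \<delta> by (auto simp: a_def power_le_one)
  define c where "c = 1 - a / ln (real N)"
  have c: "0 < c" "c < 1" "c * ln (real N) = ln (real N) - a"
    using a lnN by (auto simp: c_def field_simps)
  \<comment> \<open>On the unit cube \<open>v \<bullet> x\<close> is bounded by the l1 norm of
    \<open>v\<close>, so only finitely many integer parts occur.\<close>
  obtain M :: int where M: "\<And>v \<phi>. (v, \<phi>) \<in> V \<Longrightarrow> (\<Sum>i\<in>UNIV. \<bar>v $ i\<bar>) \<le> of_int M"
  proof
    fix v \<phi> assume "(v, \<phi>) \<in> V"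
    then have "(\<Sum>i\<in>UNIV. \<bar>v $ i\<bar>) \<le> (\<Sum>w\<in>V. \<Sum>i\<in>UNIV. \<bar>fst w $ i\<bar>)"
      using V member_le_sum[of "(v, \<phi>)" V "\<lambda>w. \<Sum>i\<in>UNIV. \<bar>fst w $ i\<bar>"] by (simp add: sum_nonneg)
    also have "\<dots> \<le> of_int \<lceil>\<Sum>w\<in>V. \<Sum>i\<in>UNIV. \<bar>fst w $ i\<bar>\<rceil>"
      by (rule le_of_int_ceiling)
    finally show "(\<Sum>i\<in>UNIV. \<bar>v $ i\<bar>) \<le> of_int \<lceil>\<Sum>w\<in>V. \<Sum>i\<in>UNIV. \<bar>fst w $ i\<bar>\<rceil>" .
  qed
  define P where "P n = (SIGMA w : V. {-M..M} \<times> large_dev N \<delta> (snd w) n)" for n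
  define plane :: "nat \<Rightarrow> ((real ^ 'n) \<times> real) \<times> int \<times> nat \<Rightarrow> (real ^ 'n) set" where
    "plane n = (\<lambda>(w, l, j). {y. fst w \<bullet> y = of_int l + real j / real N ^ n})" for n
  define C where "C = real (card V) * real (card {-M..M}) * exp pi"
  have "C \<ge> 0" by (simp add: C_def)
  have P: "finite (P n)" for n
    unfolding P_def using V by (auto intro: finite_large_dev)
  have card_P: "real (card (P n)) \<le> C * (real N ^ n * exp (- (2 * a) * real n))" for n
  proof -
    have "real (card (P n)) = (\<Sum>w\<in>V. real (card {-M..M}) * real (card (large_dev N \<delta> (snd w) n)))"
      unfolding P_def using V by (subst card_SigmaI) (auto simp: finite_large_dev card_cartesian_product)
    also have "\<dots> \<le> (\<Sum>w\<in>V. real (card {-M..M}) * (exp pi * real N ^ n * exp (- (\<delta>\<^sup>2 / 4) * real n)))"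
      by (intro sum_mono mult_left_mono card_large_dev_le N \<delta>) auto
    finally show ?thesis by (simp add: C_def a_def mult_ac)
  qed
  \<comment> \<open>The factor 2 in the radius turns the non-strict approximation error
    \<open>1 / N ^ n\<close> into the strict bound needed for an open neighbourhood.\<close>
  have cover: "K \<subseteq> (\<Union>H\<in>plane n ` P n. nbhd H (2 / real N ^ n))" if n: "n > 0" for n
  proof
    fix x assume "x \<in> K"
    then obtain v \<phi> where v: "(v, \<phi>) \<in> V" "\<delta> * real n \<le> cos_sum N \<phi> n (v \<bullet> x)"
      using large[of x n] n by blast
    define l where "l = \<lfloor>v \<bullet> x\<rfloor>"
    obtain j where j: "j \<in> large_dev N \<delta> \<phi> n"
      "\<bar>v \<bullet> x - (of_int l + real j / real N ^ n)\<bar> \<le> 1 / real N ^ n"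
      using large_dev_approx[OF N v(2)] unfolding l_def by blast
    have "\<bar>v \<bullet> x\<bar> \<le> (\<Sum>i\<in>UNIV. \<bar>v $ i * x $ i\<bar>)"
      unfolding inner_vec_def by simp
    also have "\<dots> \<le> (\<Sum>i\<in>UNIV. \<bar>v $ i\<bar>)"
      using \<open>x \<in> K\<close> K(2) by (intro sum_mono) (auto simp: abs_mult mem_box_cart intro!: mult_left_le)
    also have "\<dots> \<le> of_int M" using M v(1) by blast
    finally have "l \<in> {-M..M}"
      unfolding l_def by (auto simp: abs_le_iff le_floor_iff floor_le_iff)
    then have "((v, \<phi>), l, j) \<in> P n"
      using v j by (auto simp: P_def)
    moreover have "x \<in> nbhd (plane n ((v, \<phi>), l, j)) (2 / real N ^ n)"
    proof -
      have "1 / real N ^ n < 2 / real N ^ n"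
        using N by (simp add: field_simps)
      then show ?thesis
        unfolding plane_def using int[OF v(1)] j(2)
        by (auto intro!: near_hyperplane one_le_norm_integer_vector)
    qed
    ultimately show "x \<in> (\<Union>H\<in>plane n ` P n. nbhd H (2 / real N ^ n))"
      by blast
  qed
  have "\<exists>\<H> r. finite \<H> \<and> (\<forall>H\<in>\<H>. hyperplane H) \<and> 0 < r \<and> r \<le> 1 \<and>
      real (card \<H>) * r powr c < \<epsilon> \<and> K \<subseteq> (\<Union>H\<in>\<H>. nbhd H r)" if "\<epsilon> > 0" for \<epsilon>
  proof -
    have "0 < \<epsilon> / (2 * C + 1)" using \<open>\<epsilon> > 0\<close> \<open>C \<ge> 0\<close> by simp
    then obtain k where k: "exp (- a) ^ k < \<epsilon> / (2 * C + 1)"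
      using real_arch_pow_inv[of "\<epsilon> / (2 * C + 1)" "exp (- a)"] a by auto
    \<comment> \<open>The successor ensures \<open>n > 0\<close>, needed both for the bias and for
      \<open>r \<le> 1\<close>.\<close>
    define n where "n = Suc k"
    define r where "r = 2 / real N ^ n"
    have "2 \<le> real N"
      using N by simp
    also have "\<dots> \<le> real N ^ n"
      using N by (intro self_le_power) (auto simp: n_def)
    finally have "2 \<le> real N ^ n" .
    then have r: "0 < r" "r \<le> 1" using N by (auto simp: r_def divide_le_eq)
    have Nn: "real N ^ n = exp (real n * ln (real N))"
      using N by (simp add: exp_of_nat_mult)
    have "r powr c = 2 powr c * exp (- (real n * (c * ln (real N))))"
    proof -
      have "r = 2 * exp (- (real n * ln (real N)))"
        unfolding r_def Nn by (simp add: exp_minus field_simps)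
      then show ?thesis
        by (simp add: powr_mult exp_powr_real mult_ac)
    qed
    also have "\<dots> \<le> 2 * exp (- (real n * (c * ln (real N))))"
      using c powr_mono[of c 1 2] by (intro mult_right_mono) auto
    finally have rc: "r powr c \<le> 2 * exp (- (real n * (ln (real N) - a)))"
      by (simp only: c)
    have "real (card (plane n ` P n)) \<le> real (card (P n))"
      using card_image_le[OF P] by simp
    then have "real (card (plane n ` P n)) * r powr c
        \<le> (C * (real N ^ n * exp (- (2 * a) * real n))) * (2 * exp (- (real n * (ln (real N) - a))))"
      using card_P[of n] \<open>C \<ge> 0\<close> by (intro mult_mono rc) auto
    also have "\<dots> = 2 * C * exp (- a) ^ n"
      unfolding Nn by (simp add: exp_of_nat_mult[symmetric] algebra_simps flip: exp_add)
    also have "\<dots> \<le> (2 * C + 1) * exp (- a) ^ k"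
      unfolding n_def using a \<open>C \<ge> 0\<close> by (intro mult_mono power_decreasing) auto
    also have "\<dots> < \<epsilon>"
      using k \<open>C \<ge> 0\<close> by (simp add: field_simps)
    finally have "real (card (plane n ` P n)) * r powr c < \<epsilon>" .
    moreover have "\<forall>H\<in>plane n ` P n. hyperplane H"
      using int by (auto simp: P_def plane_def hyperplane_def affine_hyperplane aff_dim_hyperplane)
    moreover have "K \<subseteq> (\<Union>H\<in>plane n ` P n. nbhd H r)"
      unfolding r_def by (rule cover) (simp add: n_def)
    ultimately show ?thesis
      using P r by (intro exI[of _ "plane n ` P n"] exI[of _ r]) auto
  qed
  then show ?thesis using that c by blast
qed

theorem corollary1p2:
  fixes K :: "(real ^ 'n) set" and N :: nat
  assumes "CARD('n) \<ge> 2" and "N \<ge> 2"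
    and "closed K" and "K \<subset> cbox 0 1" and "torus_invariant N K"
  shows "tube_null K \<and>
    (\<exists>c::real. 0 < c \<and> c < 1 \<and>
      (\<forall>\<epsilon>>0. \<exists>(I :: nat set) (H :: nat \<Rightarrow> (real ^ 'n) set) (r :: nat \<Rightarrow> real).
        (\<forall>i\<in>I. hyperplane (H i) \<and> r i > 0) \<and>
        (\<lambda>i. r i powr c) summable_on I \<and>
        (\<Sum>\<^sub>\<infinity>i\<in>I. r i powr c) < \<epsilon> \<and>
        K \<subseteq> (\<Union>i\<in>I. nbhd (H i) (r i))))"
proof -
  obtain c :: real where c: "0 < c" "c < 1"
    and cover: "\<And>\<epsilon>. \<epsilon> > 0 \<Longrightarrow> \<exists>\<H> r. finite \<H> \<and> (\<forall>H\<in>\<H>. hyperplane H) \<and> 0 < r \<and> r \<le> 1 \<and>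
      real (card \<H>) * r powr c < \<epsilon> \<and> K \<subseteq> (\<Union>H\<in>\<H>. nbhd H r)"
    using ex_small_hyperplane_cover[OF assms(2-5)] by metis
  have "tube_null K"
  proof (rule tube_null_if_hyperplane_covers[OF assms(1)])
    show "K \<subseteq> cbox 0 1" using assms(4) by blast
    fix \<epsilon> :: real assume "\<epsilon> > 0"
    then obtain \<H> r where *: "finite \<H>" "\<forall>H\<in>\<H>. hyperplane H" "0 < r" "r \<le> 1"
      "real (card \<H>) * r powr c < \<epsilon>" "K \<subseteq> (\<Union>H\<in>\<H>. nbhd H r)"
      using cover[OF \<open>\<epsilon> > 0\<close>] by blast
    \<comment> \<open>As \<open>r \<le> 1\<close> and \<open>c < 1\<close>, smallness of the sum
      with exponent \<open>c\<close> implies smallness with exponent 1, which is what tubes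
      require.\<close>
    have "r powr 1 \<le> r powr c"
      using * c by (intro powr_mono') auto
    then have "real (card \<H>) * r \<le> real (card \<H>) * r powr c"
      using * by (intro mult_left_mono) auto
    then show "\<exists>\<H> r. finite \<H> \<and> (\<forall>H\<in>\<H>. hyperplane H) \<and> 0 < r \<and> r \<le> 1 \<and>
        real (card \<H>) * r < \<epsilon> \<and> K \<subseteq> (\<Union>H\<in>\<H>. nbhd H r)"
      using * by (intro exI[of _ \<H>] exI[of _ r]) auto
  qed
  moreover have "\<exists>(I :: nat set) (H :: nat \<Rightarrow> (real ^ 'n) set) (r :: nat \<Rightarrow> real).
        (\<forall>i\<in>I. hyperplane (H i) \<and> r i > 0) \<and>
        (\<lambda>i. r i powr c) summable_on I \<and>
        (\<Sum>\<^sub>\<infinity>i\<in>I. r i powr c) < \<epsilon> \<and>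
        K \<subseteq> (\<Union>i\<in>I. nbhd (H i) (r i))" if \<epsilon>: "\<epsilon> > 0" for \<epsilon>
  proof -
    obtain \<H> r where *: "finite \<H>" "\<forall>H\<in>\<H>. hyperplane H" "0 < r"
      "real (card \<H>) * r powr c < \<epsilon>" "K \<subseteq> (\<Union>H\<in>\<H>. nbhd H r)"
      using cover[OF \<epsilon>] by blast
    obtain I and H :: "nat \<Rightarrow> (real ^ 'n) set" where I: "finite I" "H ` I = \<H>" "card I = card \<H>"
      using finite_family_nat_indexed[OF *(1)] .
    show ?thesis
      using * I(1,3) unfolding I(2)[symmetric]
      by (intro exI[of _ I] exI[of _ H] exI[of _ "\<lambda>_. r"]) (simp add: summable_on_finite)
  qed
  ultimately show ?thesis using c by blast
qed

end
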